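(* Let $g:D\to\mathbb{C}$ be a discrete holomorphic function with cross ratio factorizing function $\alpha$, let $\lambda\in\mathbb{R}\setminus\{0\}$, and let $E$ be a lift on $D$, with $\det E_p>0$ for all $p$, satisfying $$E_q-E_p=E_p\begin{pmatrix}0& g_q-g_p\\ \frac{\lambda\alpha_{pq}}{g_q-g_p}&0\end{pmatrix}.$$ For any $t\in\mathbb{R}$ (with $1+t|g_p|^2>0$ for all $p\in D$, so that the matrices below are defined), let $E_p(t)=E_pL_p$ with $$L_p=\begin{pmatrix}\sqrt{\frac{1+tg_p\bar g_p}{1+t^2g_p\bar g_p}} & -tg_p\sqrt{\frac{1+tg_p\bar g_p}{1+t^2g_p\bar g_p}}\\ 0&\sqrt{\frac{1+t^2g_p\bar g_p}{1+tg_p\bar g_p}}\end{pmatrix},$$ and let $f_{t,p}=\frac{1}{\det E_p(t)}E_p(t)\overline{E_p(t)}^T\in\mathbb{H}^3$ be the resulting discrete linear Weingarten surface of Bryant type. Then $f_t$ has concircular quadrilaterals: for every unit square of $D$ with vertices $p,q,r,s$, the four points $f_{t,p},f_{t,q},f_{t,r},f_{t,s}$ are concircular.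
   Context: Domain and discrete holomorphic functions: $D$ is $\mathbb{Z}^2$ or a subdomain of it. A map $g:D\to\mathbb{C}$, with $g_q\neq g_p$ for all adjacent $p,q\in D$, is discrete holomorphic if there is a real-valued function $\alpha$ on the (unoriented) edges of $D$, called a cross ratio factorizing function, such that on each unit square $\frac{(g_{m+1,n}-g_{m,n})(g_{m,n+1}-g_{m+1,n+1})}{(g_{m+1,n+1}-g_{m+1,n})(g_{m,n}-g_{m,n+1})}=\frac{\alpha_{(m,n)(m+1,n)}}{\alpha_{(m,n)(m,n+1)}}<0$, with $\alpha_{(m,n)(m+1,n)}=\alpha_{(m,n+1)(m+1,n+1)}$ and $\alpha_{(m,n)(m,n+1)}=\alpha_{(m+1,n)(m+1,n+1)}$. Hyperbolic space: $\mathbb{R}^{3,1}$ (metric $-dx_0^2+dx_1^2+dx_2^2+dx_3^2$) is identified with Hermitian $2\times2$ matrices $\begin{pmatrix} x_0+x_3 & x_1+ix_2\\ x_1-ix_2& x_0-x_3\end{pmatrix}$, and $\mathbb{H}^3$ is the set of such $X$ with $\det X=1$, $\mathrm{tr}\,X>0$. The equation for the $2\times2$ complex matrices $E_p$ is imposed for edges $pq$ with $q=p+(1,0)$ or $q=p+(0,1)$ (traversing an edge in the reverse direction changes $E$ only by a real scalar factor, which does not affect $f_t$). Concircular: points of $\mathbb{H}^3$ are concircular if they lie on a common circle in the Möbius-geometric sense, i.e. a circle or straight line in the conformal (Poincaré) ball model; equivalently, the points lie in a common affine $2$-plane of $\mathbb{R}^{3,1}$. *)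

theory Defs
  imports "HOL-Analysis.Analysis"
begin

section \<open>Discrete holomorphic functions\<close>

type_synonym vertex = "int \<times> int"

definition lattice_edge :: "vertex \<Rightarrow> vertex \<Rightarrow> bool"
  where "lattice_edge p q \<longleftrightarrow> q = p + (1, 0) \<or> q = p + (0, 1)"

definition unit_square :: "int \<Rightarrow> int \<Rightarrow> vertex set"
  where "unit_square m n = {(m, n), (m + 1, n), (m + 1, n + 1), (m, n + 1)}"

text \<open>
  Functions on unoriented edges are functions of the two-element set of end points of the edge.
  The inequality in the third condition forces the values of \<open>\<alpha>\<close> on the edges of a square to be
  nonzero, since \<open>x / 0 = 0\<close>.
\<close>

definition cross_ratio_factorizing ::
    "vertex set \<Rightarrow> (vertex \<Rightarrow> complex) \<Rightarrow> (vertex set \<Rightarrow> real) \<Rightarrow> bool"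
  where "cross_ratio_factorizing D g \<alpha> \<longleftrightarrow>
    (\<forall>m n. unit_square m n \<subseteq> D \<longrightarrow>
       \<alpha> {(m, n), (m + 1, n)} = \<alpha> {(m, n + 1), (m + 1, n + 1)} \<and>
       \<alpha> {(m, n), (m, n + 1)} = \<alpha> {(m + 1, n), (m + 1, n + 1)} \<and>
       \<alpha> {(m, n), (m + 1, n)} / \<alpha> {(m, n), (m, n + 1)} < 0 \<and>
       ((g (m + 1, n) - g (m, n)) * (g (m, n + 1) - g (m + 1, n + 1))) /
       ((g (m + 1, n + 1) - g (m + 1, n)) * (g (m, n) - g (m, n + 1))) =
         complex_of_real (\<alpha> {(m, n), (m + 1, n)} / \<alpha> {(m, n), (m, n + 1)}))"

definition discrete_holomorphic_with ::
    "vertex set \<Rightarrow> (vertex \<Rightarrow> complex) \<Rightarrow> (vertex set \<Rightarrow> real) \<Rightarrow> bool"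
  where "discrete_holomorphic_with D g \<alpha> \<longleftrightarrow>
    (\<forall>p\<in>D. \<forall>q\<in>D. lattice_edge p q \<longrightarrow> g q \<noteq> g p) \<and> cross_ratio_factorizing D g \<alpha>"

definition discrete_holomorphic :: "vertex set \<Rightarrow> (vertex \<Rightarrow> complex) \<Rightarrow> bool"
  where "discrete_holomorphic D g \<longleftrightarrow> (\<exists>\<alpha>. discrete_holomorphic_with D g \<alpha>)"

section \<open>Hyperbolic space\<close>

text \<open>The Hermitian matrix identified with the point \<open>(x0, x\<^sub>1, x\<^sub>2, x\<^sub>3)\<close> of Minkowski space.\<close>

definition hermitian_of :: "real \<Rightarrow> real^3 \<Rightarrow> complex^2^2"
  where "hermitian_of x0 x = vector
    [vector [complex_of_real (x0 + x$3), Complex (x$1) (x$2)],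
     vector [Complex (x$1) (- x$2), complex_of_real (x0 - x$3)]]"

definition hyperbolic_space :: "(complex^2^2) set"
  where "hyperbolic_space =
    {X. (\<exists>x0 x. X = hermitian_of x0 x) \<and> det X = 1 \<and> Re (trace X) > 0}"

definition time_coord :: "complex^2^2 \<Rightarrow> real"
  where "time_coord X = Re (X$1$1 + X$2$2) / 2"

definition space_coords :: "complex^2^2 \<Rightarrow> real^3"
  where "space_coords X = vector [Re (X$1$2), Im (X$1$2), Re (X$1$1 - X$2$2) / 2]"

lemma time_coord_hermitian_of [simp]: "time_coord (hermitian_of x0 x) = x0"
  by (simp add: time_coord_def hermitian_of_def)

lemma space_coords_hermitian_of [simp]: "space_coords (hermitian_of x0 x) = x"
  by (simp add: space_coords_def hermitian_of_def vec_eq_iff forall_3)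

text \<open>
  Stereographic projection of the hyperboloid from \<open>(-1, 0, 0, 0)\<close> onto the unit ball of the
  hyperplane \<open>x0 = 0\<close>.
\<close>

definition poincare_ball :: "complex^2^2 \<Rightarrow> real^3"
  where "poincare_ball X = (1 / (1 + time_coord X)) *\<^sub>R space_coords X"

definition is_circle :: "(real^3) set \<Rightarrow> bool"
  where "is_circle C \<longleftrightarrow>
    (\<exists>P c r. affine P \<and> aff_dim P = 2 \<and> c \<in> P \<and> r > 0 \<and> C = P \<inter> sphere c r)"

definition is_line :: "(real^3) set \<Rightarrow> bool"
  where "is_line L \<longleftrightarrow> affine L \<and> aff_dim L = 1"

definition concircular :: "(complex^2^2) set \<Rightarrow> bool"
  where "concircular S \<longleftrightarrow> S \<subseteq> hyperbolic_space \<and>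
    (\<exists>C. (is_circle C \<or> is_line C) \<and> poincare_ball ` S \<subseteq> C)"

section \<open>Discrete linear Weingarten surfaces of Bryant type\<close>

definition is_lift ::
    "vertex set \<Rightarrow> (vertex \<Rightarrow> complex) \<Rightarrow> (vertex set \<Rightarrow> real) \<Rightarrow> real \<Rightarrow>
     (vertex \<Rightarrow> complex^2^2) \<Rightarrow> bool"
  where "is_lift D g \<alpha> lam E \<longleftrightarrow>
    (\<forall>p\<in>D. \<forall>q\<in>D. lattice_edge p q \<longrightarrow>
       E q - E p = E p ** vector
         [vector [0, g q - g p],
          vector [complex_of_real (lam * \<alpha> {p, q}) / (g q - g p), 0]])"

definition L_matrix :: "real \<Rightarrow> complex \<Rightarrow> complex^2^2"
  where "L_matrix t z =
    (let a = (1 + t * (cmod z)\<^sup>2) / (1 + t\<^sup>2 * (cmod z)\<^sup>2);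
         b = (1 + t\<^sup>2 * (cmod z)\<^sup>2) / (1 + t * (cmod z)\<^sup>2)
     in vector
         [vector [complex_of_real (sqrt a), - (complex_of_real t * z * complex_of_real (sqrt a))],
          vector [0, complex_of_real (sqrt b)]])"

definition conj_transpose :: "complex^2^2 \<Rightarrow> complex^2^2"
  where "conj_transpose M = (\<chi> i j. cnj (M$j$i))"

definition hermitian_square :: "complex^2^2 \<Rightarrow> complex^2^2"
  where "hermitian_square M = (\<chi> i j. (1 / det M) * (M ** conj_transpose M)$i$j)"

definition weingarten_surface ::
    "(vertex \<Rightarrow> complex) \<Rightarrow> (vertex \<Rightarrow> complex^2^2) \<Rightarrow> real \<Rightarrow> vertex \<Rightarrow> complex^2^2"
  where "weingarten_surface g E t p = hermitian_square (E p ** L_matrix t (g p))"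

end

theory Submission
  imports Defs
begin

text \<open>
  Put \<open>h = 1 + t |g|\<^sup>2\<close> and \<open>N = E e\<^sub>2 e\<^sub>2\<^sup>* E\<^sup>* / (h det E)\<close>, the light cone lift of the hyperbolic
  Gauss map normalized against \<open>f\<^sub>t\<close>. Along an edge \<open>pq\<close> one computes
  \<open>f\<^sub>q - f\<^sub>p = (1 - t + \<lambda> \<alpha>\<^sub>p\<^sub>q h\<^sub>p h\<^sub>q / |g\<^sub>q - g\<^sub>p|\<^sup>2) (N\<^sub>q - N\<^sub>p)\<close>, so \<open>f\<^sub>t - (1 - t) N\<close> is a net parallel to
  \<open>N\<close> whose ratios have the sign of \<open>\<lambda> \<alpha>\<close>. Since \<open>\<alpha>\<close> changes sign between adjacent edges of a square,
  the two closing relations are independent, and the edges of \<open>N\<close>, hence of \<open>f\<^sub>t\<close>, span at most a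
  plane. Points of the hyperboloid in an affine plane are concircular, because stereographic
  projection satisfies \<open>(1 + x0) (|y|\<^sup>2, y, 1) = (x0 - 1, x, x0 + 1)\<close>.
\<close>

section \<open>Circles and lines in the ball model\<close>

text \<open>Absorbs the degenerate cases, in which at most one point has to be placed on a circle or
  line.\<close>

lemma is_line_exists: "\<exists>L. is_line L \<and> (c::real^3) \<in> L"
proof -
  have "is_line (affine hull {c, c + axis 1 1})"
    by (simp add: is_line_def aff_dim_2 axis_eq_0_iff)
  then show ?thesis
    by (meson hull_inc insertI1)
qed

text \<open>Completing the square turns the second equation into a sphere of possibly nonpositive
  squared radius; on the plane it leaves a circle or at most one point.\<close>

lemma plane_quadric_subset:
  fixes u v :: "real^3"
  assumes u: "u \<noteq> 0" and A: "A \<noteq> 0"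
  shows "\<exists>C. (is_circle C \<or> is_line C) \<and>
           {y. u \<bullet> y + B = 0 \<and> A * (norm y)\<^sup>2 + v \<bullet> y + b = 0} \<subseteq> C"
proof -
  define P where "P = {y. u \<bullet> y = - B}"
  define c0 where "c0 = (- 1 / (2 * A)) *\<^sub>R v"
  \<comment> \<open>This \<open>s\<close> makes \<open>c\<close> the orthogonal projection of the
    sphere's centre \<open>c0\<close> onto the plane, since \<open>is_circle\<close> wants the
    centre there.\<close>
  define s where "s = (u \<bullet> c0 + B) / (u \<bullet> u)"
  define c where "c = c0 - s *\<^sub>R u"
  define \<rho> where "\<rho> = c \<bullet> c - 2 * s * B - b / A"
  have uu: "u \<bullet> u \<noteq> 0" using u by simp
  have cP: "u \<bullet> c = - B"
    using uu by (simp add: c_def s_def inner_diff_right)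
  have key: "(dist c y)\<^sup>2 = \<rho>"
    if "u \<bullet> y + B = 0" "A * (norm y)\<^sup>2 + v \<bullet> y + b = 0" for y
  proof -
    have vy: "v \<bullet> y = - 2 * A * (c0 \<bullet> y)" using A by (simp add: c0_def)
    have "y \<bullet> y = 2 * (c0 \<bullet> y) - b / A"
      using that(2) A unfolding vy power2_norm_eq_inner by (simp add: field_simps)
    moreover have "c \<bullet> y = c0 \<bullet> y + s * B"
      using that(1) by (simp add: c_def inner_diff_left add_eq_0_iff)
    ultimately show ?thesis
      by (simp add: dist_norm power2_norm_eq_inner inner_diff_left inner_diff_right
          inner_commute \<rho>_def algebra_simps)
  qed
  show ?thesis
  proof (cases "\<rho> > 0")
    case True
    have "affine P" "aff_dim P = 2"
      using u by (auto simp: P_def affine_hyperplane aff_dim_hyperplane)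
    with True cP have "is_circle (P \<inter> sphere c (sqrt \<rho>))"
      unfolding is_circle_def by (intro exI[of _ P] exI[of _ c] exI[of _ "sqrt \<rho>"]) (auto simp: P_def)
    moreover have "{y. u \<bullet> y + B = 0 \<and> A * (norm y)\<^sup>2 + v \<bullet> y + b = 0} \<subseteq> P \<inter> sphere c (sqrt \<rho>)"
    proof safe
      fix y assume y: "u \<bullet> y + B = 0" "A * (norm y)\<^sup>2 + v \<bullet> y + b = 0"
      then show "y \<in> P" by (simp add: P_def)
      show "y \<in> sphere c (sqrt \<rho>)"
        using key[OF y] by (simp add: real_sqrt_unique)
    qed
    ultimately show ?thesis by blast
  next
    case False
    have "{y. u \<bullet> y + B = 0 \<and> A * (norm y)\<^sup>2 + v \<bullet> y + b = 0} \<subseteq> {c}"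
    proof safe
      fix y assume y: "u \<bullet> y + B = 0" "A * (norm y)\<^sup>2 + v \<bullet> y + b = 0"
      have "(dist c y)\<^sup>2 \<le> 0" using key[OF y] False by simp
      then show "y = c" by simp
    qed
    then show ?thesis using is_line_exists[of c] by blast
  qed
qed

text \<open>Two planes with a common point meet in a line unless they coincide; orthogonality of the
  extended normals \<open>(u, B)\<close> and \<open>(u', B')\<close> rules that out.\<close>

lemma two_planes_line:
  fixes u u' :: "real^3"
  assumes u: "u \<noteq> 0" and u': "u' \<noteq> 0" and orth: "u \<bullet> u' + B * B' = 0"
    and y0: "u \<bullet> y0 + B = 0" "u' \<bullet> y0 + B' = 0"
  shows "is_line {y. u \<bullet> y + B = 0 \<and> u' \<bullet> y + B' = 0}"
proof -
  have eq: "{y. u \<bullet> y + B = 0 \<and> u' \<bullet> y + B' = 0} = {y. u \<bullet> y = - B} \<inter> {y. u' \<bullet> y = - B'}"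
    by (auto simp: add_eq_0_iff2)
  have "\<not> {y. u \<bullet> y = - B} \<subseteq> {y. u' \<bullet> y = - B'}"
  proof
    assume sub: "{y. u \<bullet> y = - B} \<subseteq> {y. u' \<bullet> y = - B'}"
    \<comment> \<open>\<open>w\<close> is the part of \<open>u'\<close> orthogonal to
      \<open>u\<close>, so \<open>y0 + w\<close> stays in the first plane; inclusion in the second
      then forces \<open>w = 0\<close>.\<close>
    define s where "s = (u \<bullet> u') / (u \<bullet> u)"
    define w where "w = u' - s *\<^sub>R u"
    have uw: "u \<bullet> w = 0" using u by (simp add: w_def s_def inner_diff_right)
    have "u \<bullet> (y0 + w) = - B" using y0 uw by (simp add: inner_add_right)
    then have "u' \<bullet> (y0 + w) = - B'" using sub by blast
    then have "u' \<bullet> w = 0" using y0 by (simp add: inner_add_right)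
    then have "w \<bullet> w = 0"
      using uw by (simp add: w_def inner_diff_left inner_commute)
    then have u'_eq: "u' = s *\<^sub>R u" by (simp add: w_def)
    then have "B' = s * B" using y0 by (simp add: add_eq_0_iff)
    with orth u'_eq have "s * (u \<bullet> u + B * B) = 0"
      by (simp add: algebra_simps)
    moreover have "u \<bullet> u + B * B > 0" using u by (simp add: add_pos_nonneg)
    ultimately have "s = 0" by simp
    with u'_eq u' show False by simp
  qed
  moreover have "y0 \<in> {y. u \<bullet> y = - B} \<inter> {y. u' \<bullet> y = - B'}"
    using y0 by simp
  ultimately show ?thesis
    unfolding is_line_def eq using u
    by (auto simp: aff_dim_affine_Int_hyperplane aff_dim_hyperplane affine_hyperplane
        intro!: affine_Int)
qed

section \<open>From affine planes in Minkowski space to equations in the ball\<close>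

lemma hyperbolic_space_coords:
  assumes "X \<in> hyperbolic_space"
  shows "time_coord X > 0" "(norm (space_coords X))\<^sup>2 = (time_coord X)\<^sup>2 - 1"
proof -
  from assms obtain x0 x where X: "X = hermitian_of x0 x" "det X = 1" "Re (trace X) > 0"
    by (auto simp: hyperbolic_space_def)
  show "time_coord X > 0"
    using X(3) by (simp add: time_coord_def trace_def sum_2)
  \<comment> \<open>The determinant is minus the Minkowski square of the point,
    \<open>x0^2 - |x|^2\<close>.\<close>
  have "Re (det X) = 1" using X(2) by simp
  then show "(norm (space_coords X))\<^sup>2 = (time_coord X)\<^sup>2 - 1"
    unfolding X(1)
    by (simp add: det_2 power2_norm_eq_inner inner_vec_def sum_3)
      (simp add: hermitian_of_def algebra_simps power2_eq_square)
qed

text \<open>Linear part of \<open>(x0 - 1, x, x0 + 1)\<close>, a multiple of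
  \<open>(|y|^2, y, 1)\<close> for the projected point \<open>y\<close>. Equations
  \<open>a |y|^2 + c . y + d = 0\<close> thus become linear.\<close>

definition lin_coords :: "complex^2^2 \<Rightarrow> real \<times> (real^3) \<times> real"
  where "lin_coords X = (time_coord X, space_coords X, time_coord X)"

lemma linear_lin_coords: "linear lin_coords"
  by (rule linearI)
    (auto simp: lin_coords_def time_coord_def space_coords_def vec_eq_iff forall_3 field_simps)

text \<open>The plane lifts into a span of dimension at most 3 in a 5-dimensional space. Two
  independent normals of the span give two equations in the ball: a plane, and a sphere or second
  plane.\<close>

lemma concircular_if_planar:
  assumes S: "S \<subseteq> hyperbolic_space"
    and planar: "\<And>X. X \<in> S \<Longrightarrow> \<exists>a b. X = P + a *\<^sub>R u + b *\<^sub>R v"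
  shows "concircular S"
proof (cases "S = {}")
  case True
  then show ?thesis using is_line_exists by (auto simp: concircular_def)
next
  case False
  define e :: "real \<times> (real^3) \<times> real" where "e = (-1, 0, 1)"
  define K where "K = {lin_coords P + e, lin_coords u, lin_coords v}"
  have dim4: "dim (insert n K) < DIM(real \<times> (real^3) \<times> real)" for n
  proof -
    have "dim (insert n K) \<le> card (insert n K)"
      by (rule dim_le_card') (simp add: K_def)
    also have "\<dots> \<le> 4"
      by (simp add: K_def card_insert_if)
    finally show ?thesis by simp
  qed
  have inK: "lin_coords X + e \<in> span (insert n K)" if "X \<in> S" for X n
  proof -
    from planar[OF that] obtain a b where X: "X = P + a *\<^sub>R u + b *\<^sub>R v" by blast
    have "lin_coords X + e = (lin_coords P + e) + a *\<^sub>R lin_coords u + b *\<^sub>R lin_coords v"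
      unfolding X by (simp add: linear_add[OF linear_lin_coords] linear_cmul[OF linear_lin_coords])
    also have "\<dots> \<in> span (insert n K)"
      by (intro span_add span_mul span_base) (auto simp: K_def)
    finally show ?thesis .
  qed
  \<comment> \<open>Orthogonality to \<open>(1, 0, 0)\<close> removes the quadratic term, so
    \<open>n\<close> encodes a plane; taking \<open>n'\<close> orthogonal to \<open>n\<close> makes
    the two equations independent.\<close>
  obtain n where n: "n \<noteq> 0" "\<And>y. y \<in> span (insert (1, 0, 0) K) \<Longrightarrow> orthogonal n y"
    using orthogonal_to_subspace_exists[OF dim4] by blast
  obtain n' where n': "n' \<noteq> 0" "\<And>y. y \<in> span (insert n K) \<Longrightarrow> orthogonal n' y"
    using orthogonal_to_subspace_exists[OF dim4] by blast
  obtain A0 w B where n_eq: "n = (A0, w, B)" by (metis prod.collapse)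
  obtain A w' B' where n'_eq: "n' = (A, w', B')" by (metis prod.collapse)
  have A0: "A0 = 0"
    using n(2)[of "(1, 0, 0)"] by (simp add: n_eq orthogonal_def span_base)
  have orth: "w \<bullet> w' + B * B' = 0"
    using n'(2)[of n] by (simp add: n_eq n'_eq A0 orthogonal_def span_base inner_commute mult.commute)
  have ball: "1 + time_coord X > 0"
    "a * (norm (poincare_ball X))\<^sup>2 + c \<bullet> poincare_ball X + d
      = ((a, c, d) \<bullet> (lin_coords X + e)) / (1 + time_coord X)"
    if "X \<in> S" for X a c d
  proof -
    have X: "X \<in> hyperbolic_space" using that S by blast
    show pos: "1 + time_coord X > 0" using hyperbolic_space_coords(1)[OF X] by simp
    have "(norm (poincare_ball X))\<^sup>2 = ((time_coord X)\<^sup>2 - 1) / (1 + time_coord X)\<^sup>2"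
      using hyperbolic_space_coords(2)[OF X]
      by (simp add: poincare_ball_def power_mult_distrib power_divide)
    also have "(time_coord X)\<^sup>2 - 1 = (time_coord X - 1) * (1 + time_coord X)"
      by (simp add: algebra_simps power2_eq_square)
    finally have nrm: "(norm (poincare_ball X))\<^sup>2 = (time_coord X - 1) / (1 + time_coord X)"
      using pos by (simp add: power2_eq_square)
    then show "a * (norm (poincare_ball X))\<^sup>2 + c \<bullet> poincare_ball X + d
      = ((a, c, d) \<bullet> (lin_coords X + e)) / (1 + time_coord X)"
      unfolding nrm
      using pos by (simp add: poincare_ball_def lin_coords_def e_def add_divide_distrib add.commute[of 1 "time_coord X"])
  qed
  have 1: "w \<bullet> y + B = 0" if "y \<in> poincare_ball ` S" for y
  proof -
    from that obtain X where X: "X \<in> S" "y = poincare_ball X" by blast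
    then show ?thesis
      using n(2)[OF inK[OF X(1)]] ball(2)[OF X(1), of 0 w B]
      by (simp add: n_eq A0 orthogonal_def)
  qed
  have 2: "A * (norm y)\<^sup>2 + w' \<bullet> y + B' = 0" if "y \<in> poincare_ball ` S" for y
  proof -
    from that obtain X where X: "X \<in> S" "y = poincare_ball X" by blast
    then show ?thesis
      using n'(2)[OF inK[OF X(1)]] ball(2)[OF X(1), of A w' B']
      by (simp add: n'_eq orthogonal_def)
  qed
  from False obtain y0 where y0: "y0 \<in> poincare_ball ` S" by blast
  \<comment> \<open>With \<open>w = 0\<close> the plane equation at the point \<open>y0\<close>
    would read \<open>B = 0\<close>, hence \<open>n = 0\<close>.\<close>
  have w: "w \<noteq> 0" using 1[OF y0] n(1) by (auto simp: n_eq A0 zero_prod_def)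
  have "\<exists>C. (is_circle C \<or> is_line C) \<and> poincare_ball ` S \<subseteq> C"
  proof (cases "A = 0")
    case True
    have w': "w' \<noteq> 0" using 2[OF y0] n'(1) by (auto simp: n'_eq True zero_prod_def)
    have "is_line {y. w \<bullet> y + B = 0 \<and> w' \<bullet> y + B' = 0}"
      using two_planes_line[OF w w' orth, of y0] 1[OF y0] 2[OF y0] True by simp
    moreover have "poincare_ball ` S \<subseteq> {y. w \<bullet> y + B = 0 \<and> w' \<bullet> y + B' = 0}"
      using 1 2 True by auto
    ultimately show ?thesis by blast
  next
    case False
    have "poincare_ball ` S \<subseteq> {y. w \<bullet> y + B = 0 \<and> A * (norm y)\<^sup>2 + w' \<bullet> y + B' = 0}"
      using 1 2 by auto
    then show ?thesis
      using plane_quadric_subset[OF w False, of B w' B'] by (meson order_trans)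
  qed
  with S show ?thesis by (simp add: concircular_def)
qed

section \<open>Parallel nets\<close>

text \<open>
  Subtracting \<open>a2\<close> times the closing relation of the quadrilateral \<open>N\<close> from that of \<open>f - c N\<close>
  eliminates one edge, so the edges of \<open>N\<close> span at most a plane.
\<close>

lemma parallel_quadrilateral_planar:
  fixes f1 f2 f3 f4 N1 N2 N3 N4 :: "'a::real_vector"
  assumes e1: "f2 - f1 = (c + a1) *\<^sub>R (N2 - N1)"
    and e2: "f3 - f2 = (c + a2) *\<^sub>R (N3 - N2)"
    and e3: "f4 - f3 = (c + a3) *\<^sub>R (N4 - N3)"
    and e4: "f1 - f4 = (c + a4) *\<^sub>R (N1 - N4)"
    and "a1 \<noteq> a2" and X: "X \<in> {f1, f2, f3, f4}"
  shows "\<exists>a b. X = f1 + a *\<^sub>R (N4 - N3) + b *\<^sub>R (N1 - N4)"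
proof -
  define d3 where "d3 = N4 - N3"
  define d4 where "d4 = N1 - N4"
  have "(c + a1) *\<^sub>R (N2 - N1) + (c + a2) *\<^sub>R (N3 - N2) + (c + a3) *\<^sub>R (N4 - N3)
      + (c + a4) *\<^sub>R (N1 - N4) = 0"
    unfolding e1[symmetric] e2[symmetric] e3[symmetric] e4[symmetric] by simp
  then have "(a1 - a2) *\<^sub>R (N2 - N1) = (a2 - a3) *\<^sub>R d3 + (a2 - a4) *\<^sub>R d4"
    unfolding d3_def d4_def by (simp add: algebra_simps)
  then have "N2 - N1 = (1 / (a1 - a2)) *\<^sub>R ((a2 - a3) *\<^sub>R d3 + (a2 - a4) *\<^sub>R d4)"
    using \<open>a1 \<noteq> a2\<close> by (metis divide_self_if eq_iff_diff_eq_0 scaleR_one scaleR_scaleR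
        times_divide_eq_left mult_1)
  then have d1: "N2 - N1 = ((a2 - a3) / (a1 - a2)) *\<^sub>R d3 + ((a2 - a4) / (a1 - a2)) *\<^sub>R d4"
    by (simp add: scaleR_add_right)
  have f4: "f4 = f1 + 0 *\<^sub>R d3 + (- (c + a4)) *\<^sub>R d4"
    using e4 unfolding d4_def[symmetric] by (simp add: algebra_simps)
  have f3: "f3 = f1 + (- (c + a3)) *\<^sub>R d3 + (- (c + a4)) *\<^sub>R d4"
    using e3 f4 unfolding d3_def[symmetric] by (simp add: algebra_simps)
  have f2: "f2 = f1 + ((c + a1) * ((a2 - a3) / (a1 - a2))) *\<^sub>R d3
      + ((c + a1) * ((a2 - a4) / (a1 - a2))) *\<^sub>R d4"
    using e1 unfolding d1 scaleR_add_right scaleR_scaleR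
    by (metis add.assoc add.commute diff_add_cancel)
  have f1: "f1 = f1 + 0 *\<^sub>R d3 + 0 *\<^sub>R d4" by simp
  show ?thesis
    using X f1 f2 f3 f4 unfolding d3_def[symmetric] d4_def[symmetric] by blast
qed

section \<open>The Weingarten surface and its hyperbolic Gauss map\<close>

text \<open>Congruence action, real-linear in \<open>X\<close> and compatible with products of
  \<open>P\<close>; it carries identities in the identity frame over to the frame
  \<open>E p\<close>.\<close>

definition sandwich :: "complex^2^2 \<Rightarrow> complex^2^2 \<Rightarrow> complex^2^2"
  where "sandwich P X = P ** X ** conj_transpose P"

lemmas mat2_simps = vec_eq_iff forall_2 matrix_matrix_mult_def sum_2 conj_transpose_def
  scaleR_conv_of_real[where 'a=complex]

lemma conj_transpose_mult: "conj_transpose (A ** B) = conj_transpose B ** conj_transpose A"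
  by (simp add: mat2_simps mult.commute)

lemma sandwich_mult: "sandwich (P ** U) X = sandwich P (sandwich U X)"
  by (simp add: sandwich_def conj_transpose_mult matrix_mul_assoc)

lemma linear_sandwich: "linear (sandwich P)"
  by (rule linearI) (simp_all add: sandwich_def mat2_simps algebra_simps)

lemma hermitian_square_eq:
  assumes "Im (det F) = 0"
  shows "hermitian_square F = (1 / Re (det F)) *\<^sub>R (F ** conj_transpose F)"
proof -
  have "det F = complex_of_real (Re (det F))" using assms by (simp add: complex_eq_iff)
  then have "1 / det F = complex_of_real (1 / Re (det F))" by (metis of_real_1 of_real_divide)
  then show ?thesis by (simp add: hermitian_square_def vec_eq_iff scaleR_conv_of_real[where 'a=complex])
qed

text \<open>For real \<open>det F\<close> the determinant of \<open>F F^*\<close> is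
  \<open>(det F)^2\<close>. The trace is a positive multiple of the sum of the squared moduli of the
  entries, which cannot all vanish.\<close>

lemma hermitian_square_in_hyperbolic_space:
  assumes "Im (det F) = 0" "Re (det F) > 0"
  shows "hermitian_square F \<in> hyperbolic_space"
proof -
  define d where "d = Re (det F)"
  have dF: "det F = complex_of_real d" and d: "d > 0"
    using assms by (simp_all add: d_def complex_eq_iff)
  define X where "X = hermitian_square F"
  have X: "X = (1 / d) *\<^sub>R (F ** conj_transpose F)"
    using hermitian_square_eq[OF assms(1)] by (simp add: X_def d_def)
  have "det (conj_transpose F) = cnj (det F)"
    by (simp add: det_2 conj_transpose_def mult.commute)
  then have "det (F ** conj_transpose F) = complex_of_real (d\<^sup>2)"
    by (simp add: det_mul dF power2_eq_square)
  moreover have "det X = complex_of_real (1 / d\<^sup>2) * det (F ** conj_transpose F)"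
    unfolding X by (simp add: det_2 scaleR_conv_of_real[where 'a=complex] power2_eq_square algebra_simps)
  ultimately have "det X = 1" using d by simp
  moreover have "X = hermitian_of (time_coord X) (space_coords X)"
    unfolding X hermitian_of_def time_coord_def space_coords_def
    by (simp add: mat2_simps complex_eq_iff diff_divide_distrib add_divide_distrib mult.commute)
  moreover have "Re (trace X) > 0"
  proof -
    have "Re (trace X) = ((cmod (F$1$1))\<^sup>2 + (cmod (F$1$2))\<^sup>2 + (cmod (F$2$1))\<^sup>2 + (cmod (F$2$2))\<^sup>2) / d"
      unfolding X cmod_power2 by (simp add: trace_def mat2_simps power2_eq_square add_divide_distrib)
    moreover have "(cmod (F$1$1))\<^sup>2 + (cmod (F$1$2))\<^sup>2 + (cmod (F$2$1))\<^sup>2 + (cmod (F$2$2))\<^sup>2 \<noteq> 0"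
    proof
      assume "(cmod (F$1$1))\<^sup>2 + (cmod (F$1$2))\<^sup>2 + (cmod (F$2$1))\<^sup>2 + (cmod (F$2$2))\<^sup>2 = 0"
      then have "F$1$1 = 0" "F$1$2 = 0"
        by (simp_all add: add_nonneg_eq_0_iff)
      then show False using dF d by (simp add: det_2)
    qed
    ultimately show ?thesis using d
      by (simp add: less_le)
  qed
  ultimately show ?thesis unfolding X_def[symmetric] hyperbolic_space_def by blast
qed

text \<open>The product \<open>L L^*\<close> in closed form, free of square roots: the surface point
  in the identity frame.\<close>

definition L_gram :: "real \<Rightarrow> complex \<Rightarrow> complex^2^2"
  where "L_gram t z = vector
    [vector [complex_of_real (1 + t * (cmod z)\<^sup>2), - (complex_of_real t * z)],
     vector [- (complex_of_real t * cnj z),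
             complex_of_real ((1 + t\<^sup>2 * (cmod z)\<^sup>2) / (1 + t * (cmod z)\<^sup>2))]]"

text \<open>The two radicands are reciprocal, so the roots cancel in the mixed products and in the
  determinant.\<close>

lemma L_matrix_gram:
  assumes "1 + t * (cmod z)\<^sup>2 > 0"
  shows "L_matrix t z ** conj_transpose (L_matrix t z) = L_gram t z" "det (L_matrix t z) = 1"
proof -
  define a where "a = (1 + t * (cmod z)\<^sup>2) / (1 + t\<^sup>2 * (cmod z)\<^sup>2)"
  define b where "b = (1 + t\<^sup>2 * (cmod z)\<^sup>2) / (1 + t * (cmod z)\<^sup>2)"
  have pos: "1 + t\<^sup>2 * (cmod z)\<^sup>2 > 0" by (simp add: add_pos_nonneg)
  have a: "a > 0" "b > 0" and ab: "a * b = 1" using assms pos by (simp_all add: a_def b_def)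
  have aN: "a * (1 + t\<^sup>2 * (cmod z)\<^sup>2) = 1 + t * (cmod z)\<^sup>2" using pos by (simp add: a_def)
  have sab: "complex_of_real (sqrt a) * complex_of_real (sqrt b) = 1"
    using ab by (metis of_real_1 of_real_mult real_sqrt_mult real_sqrt_one)
  have saa: "complex_of_real (sqrt a) * complex_of_real (sqrt a) = complex_of_real a"
    using a by (metis less_imp_le of_real_mult real_sqrt_mult_self abs_of_pos)
  have sbb: "complex_of_real (sqrt b) * complex_of_real (sqrt b) = complex_of_real b"
    using a by (metis less_imp_le of_real_mult real_sqrt_mult_self abs_of_pos)
  have L: "L_matrix t z = vector
         [vector [complex_of_real (sqrt a), - (complex_of_real t * z * complex_of_real (sqrt a))],
          vector [0, complex_of_real (sqrt b)]]"
    by (simp add: L_matrix_def a_def b_def Let_def)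
  show "det (L_matrix t z) = 1" by (simp add: L det_2 sab)
  have "complex_of_real (sqrt a) * complex_of_real (sqrt a) +
        complex_of_real t * z * complex_of_real (sqrt a) * (complex_of_real t * cnj z * complex_of_real (sqrt a))
      = complex_of_real a * (1 + (complex_of_real t)\<^sup>2 * (z * cnj z))"
    unfolding saa[symmetric] by (simp add: algebra_simps power2_eq_square)
  also have "\<dots> = complex_of_real (a * (1 + t\<^sup>2 * (cmod z)\<^sup>2))"
    unfolding complex_norm_square[symmetric] by simp
  finally have 11: "complex_of_real (sqrt a) * complex_of_real (sqrt a) +
        complex_of_real t * z * complex_of_real (sqrt a) * (complex_of_real t * cnj z * complex_of_real (sqrt a))
      = complex_of_real (1 + t * (cmod z)\<^sup>2)" unfolding aN .
  have 12: "complex_of_real t * z * complex_of_real (sqrt a) * complex_of_real (sqrt b) = complex_of_real t * z" for z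
    using sab by (simp add: mult.assoc)
  have 21: "complex_of_real (sqrt b) * (complex_of_real t * z * complex_of_real (sqrt a)) = complex_of_real t * z" for z
    using 12[of z] by (simp add: ac_simps)
  show "L_matrix t z ** conj_transpose (L_matrix t z) = L_gram t z"
    using 11 12 21 sbb unfolding L by (simp add: L_gram_def mat2_simps b_def[symmetric])
qed

lemma hermitian_square_mult_L_matrix:
  assumes "1 + t * (cmod z)\<^sup>2 > 0" "Im (det P) = 0"
  shows "hermitian_square (P ** L_matrix t z) = (1 / Re (det P)) *\<^sub>R sandwich P (L_gram t z)"
proof -
  have "(P ** L_matrix t z) ** conj_transpose (P ** L_matrix t z)
      = P ** (L_matrix t z ** conj_transpose (L_matrix t z)) ** conj_transpose P"
    by (simp add: conj_transpose_mult matrix_mul_assoc)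
  then show ?thesis
    using hermitian_square_eq[of "P ** L_matrix t z"] assms
    by (simp add: det_mul L_matrix_gram sandwich_def)
qed

text \<open>Transition \<open>E q = E p ** step_matrix w x\<close> of the lift along an edge; for
  \<open>w \<noteq> 0\<close> its determinant is \<open>1 - x\<close>.\<close>

definition step_matrix :: "complex \<Rightarrow> real \<Rightarrow> complex^2^2"
  where "step_matrix w x = vector [vector [1, w], vector [complex_of_real x / w, 1]]"

text \<open>The rank-one matrix \<open>e2 e2^*\<close>: \<open>sandwich P e22\<close> is the
  light-like matrix built from the second column of \<open>P\<close>.\<close>

definition e22 :: "complex^2^2"
  where "e22 = vector [vector [0, 0], vector [0, 1]]"

text \<open>
  Congruence with \<open>E\<^sub>p\<close> reduces the edge \<open>pq\<close> to the frame \<open>E\<^sub>p = 1\<close>, with \<open>z = g\<^sub>p\<close>, \<open>w = g\<^sub>q - g\<^sub>p\<close> and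
  \<open>x = \<lambda> \<alpha>\<^sub>p\<^sub>q\<close>. These are the four matrix entries, with \<open>zc\<close> and \<open>wc\<close> in the role of the conjugates.
\<close>

lemma frame_identities:
  fixes z zc w wc x t h h' k :: "'a::field"
  assumes h: "h = 1 + t * (z * zc)" and h': "h' = 1 + t * ((z + w) * (zc + wc))"
    and k: "k = 1 - x" and nz: "h \<noteq> 0" "h' \<noteq> 0" "w \<noteq> 0" "wc \<noteq> 0" "k \<noteq> 0"
  defines "c \<equiv> 1 - t + x * h * h' / (w * wc)"
    and "m \<equiv> (1 + t\<^sup>2 * (z * zc)) / h"
    and "m' \<equiv> (1 + t\<^sup>2 * ((z + w) * (zc + wc))) / h'"
  shows "(h' - w * (t * (zc + wc)) + (w * m' - t * (z + w)) * wc) / k - h = c * (w * wc) / (k * h')"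
    and "((h' - w * (t * (zc + wc))) * x / wc + (w * m' - t * (z + w))) / k + t * z = c * w / (k * h')"
    and "(x * h' / w - t * (zc + wc) + (m' - x * (t * (z + w)) / w) * wc) / k + t * zc = c * wc / (k * h')"
    and "((x * h' / w - t * (zc + wc)) * x / wc + (m' - x * (t * (z + w)) / w)) / k - m = c * (1 / (k * h') - 1 / h)"
proof -
  \<comment> \<open>Variables for the quotients turn the entries into polynomial identities modulo
    \<open>y * w = x\<close> and \<open>q * wc = 1\<close>.\<close>
  define y where "y = x / w"
  define q where "q = 1 / wc"
  define s where "s = (1 - t) / h"
  define s' where "s' = (1 - t) / h'"
  have yq: "y * w = x" "q * wc = 1"
    using nz by (simp_all add: y_def q_def)
  \<comment> \<open>This is \<open>1 + t^2 z zc = t h + (1 - t)\<close> divided by \<open>h\<close>,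
    and likewise for \<open>h'\<close>.\<close>
  have m: "m = t + s" and m': "m' = t + s'"
    using nz unfolding m_def m'_def s_def s'_def
    by (simp_all add: field_simps) (simp_all add: h h' algebra_simps power2_eq_square)
  have c': "c / h' = s' + h * y * q" and c: "c / h = s + h' * y * q"
    using nz unfolding c_def y_def q_def s_def s'_def by (simp_all add: field_simps)
  have div: "A / k + B = c * C / (k * h')" if "A + k * B = (s' + h * y * q) * C" for A B C
  proof -
    have "A / k + B = (A + k * B) / k" using nz by (simp add: field_simps)
    also have "\<dots> = (c / h') * C / k" unfolding that c' ..
    finally show ?thesis by (simp add: mult.commute)
  qed
  show "(h' - w * (t * (zc + wc)) + (w * m' - t * (z + w)) * wc) / k - h = c * (w * wc) / (k * h')"
  proof -
    have "(h' - w * (t * (zc + wc)) + (w * m' - t * (z + w)) * wc) + k * (- h) = (s' + h * y * q) * (w * wc)"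
      unfolding h h' k m' yq(1)[symmetric] using yq(2) by algebra
    from div[OF this] show ?thesis by simp
  qed
  show "((h' - w * (t * (zc + wc))) * x / wc + (w * m' - t * (z + w))) / k + t * z = c * w / (k * h')"
  proof -
    have "(h' - w * (t * (zc + wc))) * (x * q) + (w * m' - t * (z + w)) + k * (t * z) = (s' + h * y * q) * w"
      unfolding h h' k m' yq(1)[symmetric] using yq(2) by algebra
    from div[OF this] show ?thesis by (simp add: q_def)
  qed
  show "(x * h' / w - t * (zc + wc) + (m' - x * (t * (z + w)) / w) * wc) / k + t * zc = c * wc / (k * h')"
  proof -
    have "y * h' - t * (zc + wc) + (m' - y * (t * (z + w))) * wc + k * (t * zc) = (s' + h * y * q) * wc"
      unfolding h h' k m' yq(1)[symmetric] using yq(2) by algebra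
    from div[OF this] show ?thesis by (simp add: y_def)
  qed
  show "((x * h' / w - t * (zc + wc)) * x / wc + (m' - x * (t * (z + w)) / w)) / k - m = c * (1 / (k * h') - 1 / h)"
  proof -
    \<comment> \<open>Only this entry sees the term \<open>e22 / h\<close> of the base point;
      \<open>c / h\<close> is moved to the left before dividing by \<open>k\<close>.\<close>
    define A where "A = (y * h' - t * (zc + wc)) * (x * q) + (m' - y * (t * (z + w)))"
    have "A + k * (s + h' * y * q - m) = (s' + h * y * q) * 1"
      unfolding A_def h h' k m m' yq(1)[symmetric] using yq(2) by algebra
    from div[OF this] have "A / k + (c / h - m) = c / (k * h')"
      by (simp add: c)
    moreover have A: "A = (x * h' / w - t * (zc + wc)) * x / wc + (m' - x * (t * (z + w)) / w)"
      by (simp add: A_def y_def q_def)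
    ultimately show ?thesis by (simp add: algebra_simps flip: A)
  qed
qed

lemma frame_identity:
  assumes k: "k = 1 - x" "k \<noteq> 0" and w: "w \<noteq> 0"
    and h: "h = 1 + t * (cmod z)\<^sup>2" "h \<noteq> 0"
    and h': "h' = 1 + t * (cmod (z + w))\<^sup>2" "h' \<noteq> 0"
  shows "(1 / k) *\<^sub>R sandwich (step_matrix w x) (L_gram t (z + w)) - L_gram t z
    = (1 - t + x * h * h' / (cmod w)\<^sup>2) *\<^sub>R
        ((1 / (k * h')) *\<^sub>R sandwich (step_matrix w x) e22 - (1 / h) *\<^sub>R e22)"
proof -
  have cn: "(complex_of_real (cmod v))\<^sup>2 = v * cnj v" for v
    by (metis complex_norm_square of_real_power)
  have H: "complex_of_real h = 1 + complex_of_real t * (z * cnj z)"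
    and H': "complex_of_real h' = 1 + complex_of_real t * ((z + w) * (cnj z + cnj w))"
    by (simp_all add: h(1) h'(1) cn)
  have nz: "complex_of_real k = 1 - complex_of_real x" "complex_of_real h \<noteq> 0"
    "complex_of_real h' \<noteq> 0" "w \<noteq> 0" "cnj w \<noteq> 0" "complex_of_real k \<noteq> 0"
    using k w h(2) h'(2) by simp_all
  show ?thesis
    using frame_identities[OF H H' nz]
    by (simp add: mat2_simps sandwich_def step_matrix_def e22_def L_gram_def
        h(1)[symmetric] h'(1)[symmetric] cn)
qed

section \<open>The edge relation between the surface and its Gauss map\<close>

definition gauss_lift ::
    "(vertex \<Rightarrow> complex) \<Rightarrow> (vertex \<Rightarrow> complex^2^2) \<Rightarrow> real \<Rightarrow> vertex \<Rightarrow> complex^2^2"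
  where "gauss_lift g E t p =
    (1 / (Re (det (E p)) * (1 + t * (cmod (g p))\<^sup>2))) *\<^sub>R sandwich (E p) e22"

text \<open>Since \<open>E q = E p ** U\<close>, both edge differences are images under
  \<open>sandwich (E p)\<close> of differences in the identity frame; linearity transports
  \<open>frame_identity\<close>.\<close>

lemma weingarten_edge_parallel:
  assumes lift: "is_lift D g \<alpha> lam E"
    and pq: "p \<in> D" "q \<in> D" "lattice_edge p q" "g q \<noteq> g p"
    and dets: "\<forall>p\<in>D. Im (det (E p)) = 0 \<and> Re (det (E p)) > 0"
    and hs: "\<forall>p\<in>D. 1 + t * (cmod (g p))\<^sup>2 > 0"
  shows "weingarten_surface g E t q - weingarten_surface g E t p =
    (1 - t + lam * \<alpha> {p, q} * ((1 + t * (cmod (g p))\<^sup>2) * (1 + t * (cmod (g q))\<^sup>2)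
       / (cmod (g q - g p))\<^sup>2)) *\<^sub>R (gauss_lift g E t q - gauss_lift g E t p)"
proof -
  define x where "x = lam * \<alpha> {p, q}"
  define w where "w = g q - g p"
  define k where "k = 1 - x"
  define d where "d = Re (det (E p))"
  define h where "h = 1 + t * (cmod (g p))\<^sup>2"
  define h' where "h' = 1 + t * (cmod (g q))\<^sup>2"
  define c where "c = 1 - t + x * h * h' / (cmod w)\<^sup>2"
  define U where "U = step_matrix w x"
  have gq: "g p + w = g q" by (simp add: w_def)
  have w: "w \<noteq> 0" using pq(4) by (simp add: w_def)
  have h: "h > 0" "h' > 0" using hs pq by (simp_all add: h_def h'_def)
  have "E q - E p = E p ** vector [vector [0, w], vector [complex_of_real x / w, 0]]"
    using lift pq by (auto simp: is_lift_def w_def x_def)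
  moreover have "U = mat 1 + vector [vector [0, w], vector [complex_of_real x / w, 0]]"
    by (simp add: U_def step_matrix_def mat_def vec_eq_iff forall_2)
  ultimately have Eq: "E q = E p ** U"
    by (metis add.commute diff_add_cancel matrix_add_ldistrib matrix_mul_rid)
  have "det U = complex_of_real k" using w by (simp add: U_def step_matrix_def det_2 k_def)
  then have dq: "Re (det (E q)) = d * k" by (simp add: Eq det_mul d_def)
  \<comment> \<open>\<open>d * k\<close> is the determinant at \<open>q\<close>; its positivity
    excludes \<open>k = 0\<close>.\<close>
  have d: "d > 0" "d * k > 0" using dets pq(1,2) dq[symmetric] by (simp_all add: d_def)
  then have k: "k \<noteq> 0" by auto
  note lin = linear_diff[OF linear_sandwich] linear_cmul[OF linear_sandwich]
  have fp: "weingarten_surface g E t p = (1 / d) *\<^sub>R sandwich (E p) (L_gram t (g p))"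
    using dets hs pq(1) by (simp add: weingarten_surface_def hermitian_square_mult_L_matrix d_def)
  have "weingarten_surface g E t q = (1 / (d * k)) *\<^sub>R sandwich (E q) (L_gram t (g q))"
    unfolding dq[symmetric] using dets hs pq(2)
    by (simp add: weingarten_surface_def hermitian_square_mult_L_matrix)
  then have fq: "weingarten_surface g E t q
      = (1 / d) *\<^sub>R sandwich (E p) ((1 / k) *\<^sub>R sandwich U (L_gram t (g p + w)))"
    by (simp add: Eq sandwich_mult lin gq)
  have Np: "gauss_lift g E t p = (1 / d) *\<^sub>R sandwich (E p) ((1 / h) *\<^sub>R e22)"
    by (simp add: gauss_lift_def d_def h_def lin)
  have "gauss_lift g E t q = (1 / (d * k * h')) *\<^sub>R sandwich (E q) e22"
    by (simp add: gauss_lift_def dq h'_def)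
  then have Nq: "gauss_lift g E t q
      = (1 / d) *\<^sub>R sandwich (E p) ((1 / (k * h')) *\<^sub>R sandwich U e22)"
    by (simp add: Eq sandwich_mult lin)
  have "weingarten_surface g E t q - weingarten_surface g E t p
      = (1 / d) *\<^sub>R sandwich (E p)
          ((1 / k) *\<^sub>R sandwich U (L_gram t (g p + w)) - L_gram t (g p))"
    unfolding fp fq by (simp only: lin scaleR_diff_right)
  also have "(1 / k) *\<^sub>R sandwich U (L_gram t (g p + w)) - L_gram t (g p)
      = c *\<^sub>R ((1 / (k * h')) *\<^sub>R sandwich U e22 - (1 / h) *\<^sub>R e22)"
    unfolding U_def c_def
    by (rule frame_identity) (use k w h in \<open>simp_all add: k_def h_def h'_def gq\<close>)
  also have "(1 / d) *\<^sub>R sandwich (E p) \<dots> = c *\<^sub>R (gauss_lift g E t q - gauss_lift g E t p)"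
    unfolding Np Nq by (simp only: lin scaleR_diff_right scaleR_scaleR mult.assoc mult.commute mult.left_commute)
  finally show ?thesis
    by (simp add: c_def x_def h_def h'_def w_def mult.assoc)
qed

theorem theorem4p9:
  fixes D :: "(int \<times> int) set"
    and g :: "int \<times> int \<Rightarrow> complex"
    and \<alpha> :: "(int \<times> int) set \<Rightarrow> real"
    and lam t :: real
    and E :: "int \<times> int \<Rightarrow> complex^2^2"
  assumes "discrete_holomorphic_with D g \<alpha>"
    and "lam \<noteq> 0"
    and "is_lift D g \<alpha> lam E"
    and "\<forall>p\<in>D. Im (det (E p)) = 0 \<and> Re (det (E p)) > 0"
    and "\<forall>p\<in>D. 1 + t * (cmod (g p))\<^sup>2 > 0"
  shows "\<forall>m n. unit_square m n \<subseteq> D \<longrightarrow>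
           concircular (weingarten_surface g E t ` unit_square m n)"
proof (intro allI impI)
  fix m n
  assume sq: "unit_square m n \<subseteq> D"
  define p q r s where "p = (m, n)" and "q = (m + 1, n)" and "r = (m + 1, n + 1)" and "s = (m, n + 1)"
  note vs = p_def q_def r_def s_def
  have square: "unit_square m n = {p, q, r, s}" by (simp add: unit_square_def vs)
  with sq have D: "p \<in> D" "q \<in> D" "r \<in> D" "s \<in> D" by auto
  have edges: "lattice_edge p q" "lattice_edge q r" "lattice_edge p s" "lattice_edge s r"
    by (simp_all add: lattice_edge_def vs)
  have ne: "g q \<noteq> g p" "g r \<noteq> g q" "g s \<noteq> g p" "g r \<noteq> g s"
    using assms(1) D edges unfolding discrete_holomorphic_with_def by blast+
  have "cross_ratio_factorizing D g \<alpha>"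
    using assms(1) by (simp add: discrete_holomorphic_with_def)
  with sq have \<alpha>: "\<alpha> {p, s} = \<alpha> {q, r}" "\<alpha> {p, q} / \<alpha> {p, s} < 0"
    unfolding cross_ratio_factorizing_def vs by blast+
  define h where "h u = 1 + t * (cmod (g u))\<^sup>2" for u
  \<comment> \<open>The part of the edge ratio beyond \<open>1 - t\<close>; the factor next to
    \<open>lam * \<alpha> {u, v}\<close> is positive on edges.\<close>
  define a where "a u v = lam * \<alpha> {u, v} * (h u * h v / (cmod (g v - g u))\<^sup>2)" for u v
  have edge: "weingarten_surface g E t v - weingarten_surface g E t u
      = (1 - t + a u v) *\<^sub>R (gauss_lift g E t v - gauss_lift g E t u)"
    if "u \<in> D" "v \<in> D" "lattice_edge u v" "g v \<noteq> g u" for u v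
    using weingarten_edge_parallel[OF assms(3) that assms(4,5)] by (simp add: a_def h_def)
  \<comment> \<open>The cycle \<open>p, q, r, s\<close> traverses the edges \<open>s r\<close> and
    \<open>p s\<close> backwards; reversal keeps the ratio.\<close>
  have flip: "weingarten_surface g E t u - weingarten_surface g E t v
      = (1 - t + a u v) *\<^sub>R (gauss_lift g E t u - gauss_lift g E t v)"
    if "u \<in> D" "v \<in> D" "lattice_edge u v" "g v \<noteq> g u" for u v
    using arg_cong[OF edge[OF that], of uminus] by (simp flip: scaleR_minus_right)
  \<comment> \<open>Opposite edges share \<alpha>, so \<open>\<alpha> {p, q}\<close> and
    \<open>\<alpha> {q, r}\<close> have opposite signs and the two ratios differ.\<close>
  have "a p q \<noteq> a q r"
  proof
    assume eq: "a p q = a q r"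
    have pos: "h u * h v / (cmod (g v - g u))\<^sup>2 > 0" if "u \<in> D" "v \<in> D" "g v \<noteq> g u" for u v
      using assms(5) that by (simp add: h_def)
    have "\<alpha> {p, q} * (h p * h q / (cmod (g q - g p))\<^sup>2)
        = \<alpha> {q, r} * (h q * h r / (cmod (g r - g q))\<^sup>2)"
      using eq unfolding a_def mult.assoc mult_left_cancel[OF assms(2)] .
    then have "\<alpha> {p, q} > 0 \<longleftrightarrow> \<alpha> {q, r} > 0"
      using pos[OF D(1,2) ne(1)] pos[OF D(2,3) ne(2)] by (metis zero_less_mult_pos2 mult_pos_pos)
    with \<alpha> show False by (auto simp: divide_less_0_iff)
  qed
  note planar = parallel_quadrilateral_planar[OF edge[OF D(1,2) edges(1) ne(1)]
      edge[OF D(2,3) edges(2) ne(2)] flip[OF D(4,3) edges(4) ne(4)]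
      flip[OF D(1,4) edges(3) ne(3)] this]
  show "concircular (weingarten_surface g E t ` unit_square m n)"
  proof (rule concircular_if_planar)
    show "weingarten_surface g E t ` unit_square m n \<subseteq> hyperbolic_space"
    proof (safe)
      fix u assume "u \<in> unit_square m n"
      with sq have "u \<in> D" by blast
      with assms(4,5) show "weingarten_surface g E t u \<in> hyperbolic_space"
        unfolding weingarten_surface_def
        by (intro hermitian_square_in_hyperbolic_space) (simp_all add: det_mul L_matrix_gram)
    qed
    fix X assume "X \<in> weingarten_surface g E t ` unit_square m n"
    then show "\<exists>a b. X = weingarten_surface g E t p
        + a *\<^sub>R (gauss_lift g E t s - gauss_lift g E t r)
        + b *\<^sub>R (gauss_lift g E t p - gauss_lift g E t s)"
      by (intro planar) (auto simp: square)
  qed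
qed

end
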